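(* Let $\mathcal H$ be a real Hilbert space, let $r\geq 2$, let $M_1,\ldots,M_r\subseteq\mathcal H$ be closed linear subspaces, let $M:=\bigcap_{i=1}^r M_i$ and let $T:=\frac 1 r\sum_{i=1}^r P_{M_i}$. Then exactly one of the following two statements holds: (i) $\sum_{i=1}^r M_i^\perp$ is closed. Then $T^k$ converges linearly to $P_M$ and $$q=\frac{r-1}{r}\cos(M_1,\ldots,M_r)+\frac 1 r$$ is the smallest possible number, independent of $x$, in the set of all $q\in(0,1)$ such that $$\|T^k(x)-P_M(x)\|\leq q^k\|x\|$$ for all $x\in\mathcal H$ and all $k=0,1,2,\ldots$. (ii) $\sum_{i=1}^r M_i^\perp$ is not closed. Then $T^k$ converges arbitrarily slowly to $P_M$. Moreover, there is a dense linear subspace $X\subseteq\mathcal H$ on which $T^k$ converges super-polynomially fast to $P_M$.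
   Context: $P_C$ denotes the metric projection onto a nonempty closed convex set $C\subseteq\mathcal H$ (the orthogonal projection when $C$ is a closed linear subspace). The Friedrichs number of $M_1,\ldots,M_r$ with $M=\bigcap_i M_i$ is $$\cos(M_1,\ldots,M_r):=\sup\left\{\frac{1}{r-1}\frac{\sum_{i\neq j}\langle x_i,x_j\rangle}{\sum_{i=1}^r\|x_i\|^2}\ \middle|\ x_i\in M_i\cap M^\perp \text{ and } \sum_{i=1}^r\|x_i\|^2\neq 0\right\},$$ where the sum over $i\neq j$ runs over ordered pairs. Let $T,T^\infty\colon\mathcal H\to\mathcal H$ be such that $T^k(x)\to T^\infty(x)$ for every $x\in\mathcal H$. - $T^k$ converges linearly to $T^\infty$ (in the case of linear subspaces) if there are $c>0$ and $q\in(0,1)$ such that $\|T^k(x)-T^\infty(x)\|\leq cq^k\|x\|$ for all $x\in\mathcal H$ and all $k=0,1,2,\ldots$. - $T^k$ converges arbitrarily slowly to $T^\infty$ if for every sequence $\{a_k\}_{k=0}^\infty\subseteq(0,\infty)$ with $a_k\to 0$ there is $x\in\mathcal H$ such that $\|T^k(x)-T^\infty(x)\|\geq a_k$ for every $k=0,1,2,\ldots$. - $T^k$ converges super-polynomially fast to $T^\infty$ on a nonempty set $X\subseteq\mathcal H$ if $\|T^k(x)-T^\infty(x)\|/k^{-\alpha}\to 0$ as $k\to\infty$ for all $\alpha>0$ and all $x\in X$.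
   Formalization: The claim in (i) that q is the smallest number is stated only when M_1,…,M_r are not all equal; if they are all equal, the supremum defining cos(M_1,…,M_r) is over the empty set and every q in (0,1) is admissible, so no smallest one exists. *)

theory Defs
  imports "HOL-Analysis.Analysis"
begin

(* The library's closest_point has the same defining property, but its type is restricted to
   heine_borel spaces, which excludes infinite-dimensional Hilbert spaces.  The description is
   proper (unique minimiser) when C is nonempty, closed and convex in a complete space. *)
definition metric_proj :: "'a::real_inner set \<Rightarrow> 'a \<Rightarrow> 'a" where
  "metric_proj C x = (THE y. y \<in> C \<and> (\<forall>z\<in>C. dist x y \<le> dist x z))"

definition average_proj :: "nat \<Rightarrow> (nat \<Rightarrow> 'a::real_inner set) \<Rightarrow> 'a \<Rightarrow> 'a" where
  "average_proj r M x = (1 / real r) *\<^sub>R (\<Sum>i=1..r. metric_proj (M i) x)"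

(* The set under the supremum is bounded above by 1.  It is empty exactly when
   M 1 = ... = M r, and then the value is an unspecified real number. *)
definition friedrichs_number :: "nat \<Rightarrow> (nat \<Rightarrow> 'a::real_inner set) \<Rightarrow> real" where
  "friedrichs_number r M =
     Sup {1 / (real r - 1) *
            ((\<Sum>i=1..r. \<Sum>j\<in>{1..r} - {i}. x i \<bullet> x j) / (\<Sum>i=1..r. (norm (x i))\<^sup>2)) |
          x :: nat \<Rightarrow> 'a.
          (\<forall>i\<in>{1..r}. x i \<in> M i \<inter> (\<Inter>j\<in>{1..r}. M j)\<^sup>\<bottom>) \<and>
          (\<Sum>i=1..r. (norm (x i))\<^sup>2) \<noteq> 0}"

definition iterates_converge :: "('a::real_normed_vector \<Rightarrow> 'a) \<Rightarrow> ('a \<Rightarrow> 'a) \<Rightarrow> bool" where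
  "iterates_converge T Tinf \<longleftrightarrow> (\<forall>x. (\<lambda>k. (T ^^ k) x) \<longlonglongrightarrow> Tinf x)"

(* Pointwise convergence of the iterates is a standing assumption for the following
   three modes of convergence, hence a conjunct of each of them. *)
definition converges_linearly :: "('a::real_normed_vector \<Rightarrow> 'a) \<Rightarrow> ('a \<Rightarrow> 'a) \<Rightarrow> bool" where
  "converges_linearly T Tinf \<longleftrightarrow>
     iterates_converge T Tinf \<and>
     (\<exists>c>0. \<exists>q. 0 < q \<and> q < 1 \<and>
        (\<forall>x k. norm ((T ^^ k) x - Tinf x) \<le> c * q ^ k * norm x))"

definition converges_arbitrarily_slowly ::
    "('a::real_normed_vector \<Rightarrow> 'a) \<Rightarrow> ('a \<Rightarrow> 'a) \<Rightarrow> bool" where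
  "converges_arbitrarily_slowly T Tinf \<longleftrightarrow>
     iterates_converge T Tinf \<and>
     (\<forall>a :: nat \<Rightarrow> real. (\<forall>k. 0 < a k) \<and> a \<longlonglongrightarrow> 0 \<longrightarrow>
        (\<exists>x. \<forall>k. a k \<le> norm ((T ^^ k) x - Tinf x)))"

definition converges_super_polynomially_on ::
    "('a::real_normed_vector \<Rightarrow> 'a) \<Rightarrow> ('a \<Rightarrow> 'a) \<Rightarrow> 'a set \<Rightarrow> bool" where
  "converges_super_polynomially_on T Tinf X \<longleftrightarrow>
     iterates_converge T Tinf \<and> X \<noteq> {} \<and>
     (\<forall>\<alpha>>0. \<forall>x\<in>X.
        (\<lambda>k. norm ((T ^^ k) x - Tinf x) / (real k powr (- \<alpha>))) \<longlonglongrightarrow> 0)"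

definition linear_rates :: "('a::real_normed_vector \<Rightarrow> 'a) \<Rightarrow> ('a \<Rightarrow> 'a) \<Rightarrow> real set" where
  "linear_rates T Tinf =
     {q. 0 < q \<and> q < 1 \<and> (\<forall>x k. norm ((T ^^ k) x - Tinf x) \<le> q ^ k * norm x)}"

end

theory Submission
  imports Defs
begin

text \<open>Write \<open>Q\<close> for the projection onto the intersection \<open>M\<close> of the subspaces and \<open>A = I - T\<close>.  The operator \<open>T\<close> is
  linear, self-adjoint and firmly nonexpansive, that is,
  \<open>(norm (T x))\<^sup>2 + (norm (A x))\<^sup>2 \<le> (norm x)\<^sup>2\<close>, and its fixed points are exactly the elements of \<open>M\<close>.
  Since \<open>(T ^^ k) x - Q x = (T ^^ k) (x - Q x)\<close>, everything is decided on the orthogonal complement of \<open>M\<close>, in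
  which the range of \<open>A\<close> is dense.  On that range the iterates tend to zero, hence \<open>(T ^^ k) x\<close> converges to
  \<open>Q x\<close> for all \<open>x\<close>.

  The sum of the complements of the \<open>M i\<close> lies between the range of \<open>A\<close> and the complement of \<open>M\<close>; it is closed
  iff it is that whole complement.  The two cases of the theorem correspond to whether \<open>1\<close> is separated from
  the rest of the spectrum of \<open>T\<close>.  One gliding hump construction
  (\<open>gliding_hump\<close>) serves both.  If the sum is closed, it shows that the quadratic form of \<open>A\<close> is bounded below
  on the complement of \<open>M\<close> (\<open>closed_imp_coercive\<close>), so that \<open>T\<close> is a strict contraction there.  If the sum is not
  closed, no power of \<open>T\<close> is a strict contraction there, because otherwise a Neumann series, in the form of Banach's fixed
  point theorem, would invert \<open>A\<close> (\<open>nonclosed_imp_slow_vector\<close>); the gliding hump then glues almost fixed vectors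
  into an orbit that stays above any prescribed null sequence (\<open>nonclosed_imp_arbitrarily_slow\<close>).

  If the \<open>M i\<close> are not all equal, the number \<open>q\<close> is the norm of \<open>T\<close> on the complement of \<open>M\<close>.  Indeed, \<open>r T\<close> is \<open>B B*\<close> for the map
  \<open>B (x i) = \<Sum> x i\<close> on families with \<open>x i\<close> in \<open>M i\<close> and orthogonal to \<open>M\<close>, and the squared norm of \<open>B\<close> is an affine function
  of the Friedrichs number (\<open>gram_bound\<close>, \<open>contraction_of_gram_bound\<close>).

  For fast convergence, \<open>(T ^^ k) (A x)\<close> has norm at most \<open>norm x / sqrt (k + 1)\<close>, so the orbit of a vector that is divisible by
  every power of \<open>A\<close> decays faster than every power of \<open>k\<close>.  Such vectors are dense in the complement of \<open>M\<close> by the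
  Mittag-Leffler argument (\<open>dense_common_range\<close>).\<close>

section \<open>Sequences in complete normed spaces\<close>

lemma geometric_steps_limit:
  fixes s :: "nat \<Rightarrow> 'a::{real_normed_vector, complete_space}"
  assumes step: "\<And>n. norm (s (Suc n) - s n) \<le> c * q ^ n" and q: "0 \<le> q" "q < 1"
  obtains l where "s \<longlonglongrightarrow> l" and "\<And>n. norm (l - s n) \<le> c * q ^ n / (1 - q)"
proof -
  have "c \<ge> 0"
    using order_trans[OF norm_ge_zero step[of 0]] by simp
  have partial: "norm (s (n + k) - s n) \<le> c * q ^ n * (1 - q ^ k) / (1 - q)" for n k
  proof (induction k)
    case 0
    then show ?case by simp
  next
    case (Suc k)
    have "norm (s (n + Suc k) - s n) \<le> norm (s (Suc (n + k)) - s (n + k)) + norm (s (n + k) - s n)"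
      using norm_triangle_ineq[of "s (Suc (n + k)) - s (n + k)" "s (n + k) - s n"] by simp
    also have "\<dots> \<le> c * q ^ (n + k) + c * q ^ n * (1 - q ^ k) / (1 - q)"
      using step[of "n + k"] Suc by linarith
    also have "\<dots> = c * q ^ n * (1 - q ^ Suc k) / (1 - q)"
      using q by (simp add: field_simps power_add)
    finally show ?case .
  qed
  have tail: "norm (s m - s n) \<le> c * q ^ n / (1 - q)" if "n \<le> m" for m n
  proof -
    have "norm (s m - s n) \<le> c * q ^ n * (1 - q ^ (m - n)) / (1 - q)"
      using partial[of n "m - n"] that by simp
    also have "\<dots> \<le> c * q ^ n * 1 / (1 - q)"
      using q \<open>c \<ge> 0\<close> by (intro divide_right_mono mult_left_mono) auto
    finally show ?thesis by simp
  qed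
  have null: "(\<lambda>n. c * q ^ n / (1 - q)) \<longlonglongrightarrow> 0"
    using q by (auto intro!: tendsto_eq_intros LIMSEQ_power_zero)
  have "Cauchy s"
  proof (rule CauchyI')
    fix e :: real assume "0 < e"
    then obtain N where "c * q ^ N / (1 - q) < e / 2"
      using order_tendstoD(2)[OF null, of "e / 2"] unfolding eventually_sequentially by auto
    then have "dist (s m) (s n) < e" if "m \<ge> N" "n > m" for m n
      using dist_triangle2[of "s m" "s n" "s N"] tail[of N m] tail[of N n] that
      unfolding dist_norm by (smt (verit) field_sum_of_halves less_imp_le_nat order_trans)
    then show "\<exists>M. \<forall>m\<ge>M. \<forall>n>m. dist (s m) (s n) < e" by blast
  qed
  then obtain l where l: "s \<longlonglongrightarrow> l"
    by (auto simp: Cauchy_convergent_iff convergent_def)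
  have "norm (l - s n) \<le> c * q ^ n / (1 - q)" for n
  proof (rule Lim_bounded)
    show "(\<lambda>m. norm (s m - s n)) \<longlonglongrightarrow> norm (l - s n)"
      by (intro tendsto_intros l)
    show "\<forall>m\<ge>n. norm (s m - s n) \<le> c * q ^ n / (1 - q)"
      using tail by blast
  qed
  with l show ?thesis by (rule that)
qed

text \<open>The sign of each correction \<^term>\<open>(1 / 3) ^ n *\<^sub>R u n\<close> is chosen so that it does not
  cancel what has been built so far: of \<open>S n (y + w)\<close> and \<open>S n (y - w)\<close> one has at least the norm of
  \<open>S n w\<close>.  The corrections after stage \<open>n\<close> add up to at most half of the \<open>n\<close>-th, so \<open>3 / 4 - 1 / 2\<close>
  of it survives.  This serves both as a uniform boundedness principle, with inner products as
  \<open>S n\<close>, and as the source of slowly converging orbits, with powers of an operator as \<open>S n\<close>.\<close>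

lemma gliding_hump:
  fixes S :: "nat \<Rightarrow> 'a::{real_normed_vector, complete_space} \<Rightarrow> 'b::real_normed_vector"
  assumes V: "subspace V" "closed V"
    and lin: "\<And>n. linear (S n)" and contr: "\<And>n x. norm (S n x) \<le> norm x"
    and u: "\<And>n. u n \<in> V" "\<And>n. norm (u n) \<le> 1" "\<And>n. 3 / 4 \<le> norm (S n (u n))"
  obtains x where "x \<in> V" and "\<And>n. (1 / 3) ^ n / 4 \<le> norm (S n x)"
proof -
  define next_ok where "next_ok n y y' \<longleftrightarrow> norm (y' - y) \<le> (1 / 3) ^ n \<and>
    3 / 4 * (1 / 3) ^ n \<le> norm (S n y')" for n y y'
  have "\<exists>s. \<forall>n. s n \<in> V \<and> next_ok n (s n) (s (Suc n))"
  proof (rule dependent_nat_choice)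
    show "\<exists>x. x \<in> V" using u(1) by blast
  next
    fix y n assume "y \<in> V"
    define w where "w = (1 / 3 :: real) ^ n *\<^sub>R u n"
    have w: "w \<in> V" "norm w \<le> (1 / 3) ^ n"
      using V(1) u(1,2)[of n] by (auto simp: w_def subspace_scale mult_left_le)
    have Sw: "3 / 4 * (1 / 3) ^ n \<le> norm (S n w)"
      using u(3)[of n] by (simp add: w_def linear_scale[OF lin] mult.commute)
    have "2 * norm (S n w) = norm (S n (y + w) - S n (y - w))"
      by (simp add: linear_add[OF lin] linear_diff[OF lin] scaleR_2[symmetric])
    also have "\<dots> \<le> norm (S n (y + w)) + norm (S n (y - w))"
      by (rule norm_triangle_ineq4)
    finally consider "norm (S n w) \<le> norm (S n (y + w))" | "norm (S n w) \<le> norm (S n (y - w))"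
      by linarith
    then have "next_ok n y (y + w) \<or> next_ok n y (y - w)"
      using w(2) Sw unfolding next_ok_def by cases auto
    then show "\<exists>y'. y' \<in> V \<and> next_ok n y y'"
      using \<open>y \<in> V\<close> w(1) V(1) subspace_add subspace_diff by blast
  qed
  then obtain s where s: "\<And>n. s n \<in> V" "\<And>n. next_ok n (s n) (s (Suc n))" by blast
  obtain x where x: "s \<longlonglongrightarrow> x" "\<And>n. norm (x - s n) \<le> 1 * (1 / 3) ^ n / (1 - 1 / 3)"
    using geometric_steps_limit[of s 1 "1 / 3"] s(2) unfolding next_ok_def by auto
  show ?thesis
  proof
    show "x \<in> V"
      using V(2) s(1) x(1) closed_sequentially by blast
    fix n
    have "norm (S n (s (Suc n))) \<le> norm (S n x) + norm (S n (x - s (Suc n)))"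
      using norm_triangle_ineq4[of "S n x" "S n (x - s (Suc n))"]
      by (simp add: linear_diff[OF lin])
    moreover have "norm (S n (x - s (Suc n))) \<le> (1 / 3) ^ n / 2"
      using contr[of n "x - s (Suc n)"] x(2)[of "Suc n"] by simp
    moreover have "3 / 4 * (1 / 3) ^ n \<le> norm (S n (s (Suc n)))"
      using s(2)[of n] by (simp add: next_ok_def)
    ultimately show "(1 / 3) ^ n / 4 \<le> norm (S n x)" by linarith
  qed
qed

lemma linear_funpow:
  assumes "linear (f :: 'a::real_vector \<Rightarrow> 'a)"
  shows "linear (f ^^ k)"
proof (induction k)
  case 0
  then show ?case using linear_id by (simp add: id_def)
next
  case (Suc k)
  then show ?case using linear_compose[OF Suc assms] by (simp add: o_def)
qed

lemma norm_funpow_le: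
  fixes f :: "'a::real_normed_vector \<Rightarrow> 'a"
  assumes "\<And>x. norm (f x) \<le> norm x"
  shows "norm ((f ^^ k) x) \<le> norm x"
proof (induction k)
  case (Suc k)
  then show ?case using assms[of "(f ^^ k) x"] by simp
qed simp

text \<open>The Mittag-Leffler argument: starting from \<open>x\<close>, solve \<open>z n = A (z (Suc n))\<close> up to errors that
  shrink geometrically.  Since \<open>A\<close> does not increase norms, \<open>(A ^^ m) (z (n + m))\<close> converges as
  \<open>m\<close> grows, and the limits \<open>l n\<close> solve \<open>l n = A (l (Suc n))\<close> exactly; hence \<open>l 0\<close> is in every range
  and close to \<open>x\<close>.\<close>

lemma dense_common_range:
  fixes A :: "'a::{real_normed_vector, complete_space} \<Rightarrow> 'a"
  assumes lin: "linear A" and contr: "\<And>x. norm (A x) \<le> norm x"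
    and dense: "V \<subseteq> closure (A ` V)"
  shows "V \<subseteq> closure (\<Inter>n. range (A ^^ n))"
proof
  fix x assume "x \<in> V"
  have "\<exists>y \<in> (\<Inter>n. range (A ^^ n)). dist y x \<le> e" if "e > 0" for e
  proof -
    have "\<exists>z :: nat \<Rightarrow> 'a. \<forall>n. (z n \<in> V \<and> (n = (0::nat) \<longrightarrow> z n = x)) \<and> norm (z n - A (z (Suc n))) \<le> e / 2 * (1 / 2) ^ n"
    proof (rule dependent_nat_choice)
      show "\<exists>z. z \<in> V \<and> (0 = (0::nat) \<longrightarrow> z = x)" using \<open>x \<in> V\<close> by blast
    next
      fix y and n :: nat assume "y \<in> V \<and> (n = 0 \<longrightarrow> y = x)"
      then have "y \<in> closure (A ` V)" using dense by blast
      moreover have "e / 2 * (1 / 2) ^ n > 0" using \<open>e > 0\<close> by simp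
      ultimately obtain z where "z \<in> V" "dist (A z) y < e / 2 * (1 / 2) ^ n"
        unfolding closure_approachable by blast
      then show "\<exists>z. (z \<in> V \<and> (Suc n = 0 \<longrightarrow> z = x)) \<and> norm (y - A z) \<le> e / 2 * (1 / 2) ^ n"
        by (auto simp: dist_norm norm_minus_commute intro!: exI[of _ z])
    qed
    then obtain z where z: "z 0 = x" "\<And>n. norm (z n - A (z (Suc n))) \<le> e / 2 * (1 / 2) ^ n"
      by blast
    define s where "s n m = (A ^^ m) (z (n + m))" for n m
    have step: "norm (s n (Suc m) - s n m) \<le> (e / 2 * (1 / 2) ^ n) * (1 / 2) ^ m" for n m
    proof -
      have "s n (Suc m) - s n m = (A ^^ m) (A (z (Suc (n + m))) - z (n + m))"
        by (simp add: s_def linear_diff[OF linear_funpow[OF lin]] funpow_swap1)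
      also have "norm \<dots> \<le> norm (A (z (Suc (n + m))) - z (n + m))"
        by (rule norm_funpow_le[OF contr])
      also have "\<dots> \<le> e / 2 * (1 / 2) ^ (n + m)"
        using z(2) by (simp add: norm_minus_commute)
      finally show ?thesis by (simp add: power_add)
    qed
    have "\<exists>l. s n \<longlonglongrightarrow> l \<and> norm (l - s n 0) \<le> (e / 2 * (1 / 2) ^ n) / (1 - 1 / 2)" for n
    proof -
      obtain l where "s n \<longlonglongrightarrow> l"
        "\<And>m. norm (l - s n m) \<le> (e / 2 * (1 / 2) ^ n) * (1 / 2) ^ m / (1 - 1 / 2)"
        by (rule geometric_steps_limit[of "s n", OF step]) auto
      from this(1) this(2)[of 0] show ?thesis by auto
    qed
    then obtain l where l: "\<And>n. s n \<longlonglongrightarrow> l n"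
        "\<And>n. norm (l n - s n 0) \<le> (e / 2 * (1 / 2) ^ n) / (1 - 1 / 2)"
      by metis
    have blin: "bounded_linear A"
      using lin contr by (intro bounded_linear_intro[of _ 1]) (auto simp: linear_add linear_scale)
    have Al: "A (l (Suc n)) = l n" for n
    proof (rule LIMSEQ_unique)
      show "(\<lambda>m. s n (Suc m)) \<longlonglongrightarrow> l n"
        using l(1) by (rule LIMSEQ_Suc)
      show "(\<lambda>m. s n (Suc m)) \<longlonglongrightarrow> A (l (Suc n))"
        using bounded_linear.tendsto[OF blin l(1)[of "Suc n"]] by (simp add: s_def)
    qed
    have "(A ^^ n) (l n) = l 0" for n
      by (induction n) (simp_all add: funpow_swap1 Al)
    then have "l 0 \<in> (\<Inter>n. range (A ^^ n))" by (intro INT_I) (metis rangeI)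
    moreover have "dist (l 0) x \<le> e"
      using l(2)[of 0] z(1) by (simp add: dist_norm s_def)
    ultimately show ?thesis by blast
  qed
  then show "x \<in> closure (\<Inter>n. range (A ^^ n))"
    by (simp only: closure_approachable_le) blast
qed

section \<open>Orthogonal projections in Hilbert space\<close>

lemma orthogonal_compD: "x \<in> W\<^sup>\<bottom> \<Longrightarrow> v \<in> W \<Longrightarrow> x \<bullet> v = 0"
  by (auto simp: orthogonal_comp_def orthogonal_def inner_commute)

lemma orthogonal_compI: "(\<And>v. v \<in> W \<Longrightarrow> x \<bullet> v = 0) \<Longrightarrow> x \<in> W\<^sup>\<bottom>"
  by (auto simp: orthogonal_comp_def orthogonal_def inner_commute)

lemma closed_orthogonal_comp: "closed (W\<^sup>\<bottom>)"
proof -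
  have "W\<^sup>\<bottom> = (\<Inter>v\<in>W. {x. v \<bullet> x = 0})"
    by (auto simp: orthogonal_comp_def orthogonal_def)
  then show ?thesis
    by (auto intro!: closed_Collect_eq continuous_intros)
qed

lemma subspace_closure:
  fixes V :: "'a::real_normed_vector set"
  assumes "subspace V"
  shows "subspace (closure V)"
proof (rule subspaceI)
  show "0 \<in> closure V"
    using assms subspace_0 closure_subset by blast
  fix x y c assume "x \<in> closure V" "y \<in> closure V"
  then obtain f g where "\<forall>n. f n \<in> V" "f \<longlonglongrightarrow> x" "\<forall>n. g n \<in> V" "g \<longlonglongrightarrow> y"
    unfolding closure_sequential by blast
  then have "\<forall>n. f n + g n \<in> V" "(\<lambda>n. f n + g n) \<longlonglongrightarrow> x + y"
      "\<forall>n. c *\<^sub>R f n \<in> V" "(\<lambda>n. c *\<^sub>R f n) \<longlonglongrightarrow> c *\<^sub>R x"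
    by (auto intro: tendsto_add tendsto_scaleR subspace_add[OF assms] subspace_scale[OF assms])
  then show "x + y \<in> closure V" "c *\<^sub>R x \<in> closure V"
    unfolding closure_sequential
    by - (rule exI[of _ "\<lambda>n. f n + g n"], simp, rule exI[of _ "\<lambda>n. c *\<^sub>R f n"], simp)
qed

text \<open>A minimising sequence is Cauchy by the parallelogram law, because the midpoint of two of its
  members is in \<open>V\<close> and so cannot be closer to \<open>x\<close> than the infimum.\<close>

lemma nearest_point_exists:
  fixes V :: "'a::{real_inner, complete_space} set"
  assumes V: "subspace V" "closed V"
  obtains p where "p \<in> V" and "\<And>v. v \<in> V \<Longrightarrow> dist x p \<le> dist x v"
proof -
  define d where "d = infdist x V"
  have "V \<noteq> {}" using V(1) subspace_0 by blast
  have d_le: "d \<le> dist x v" if "v \<in> V" for v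
    unfolding d_def using that by (rule infdist_le)
  have "d \<ge> 0" unfolding d_def by (rule infdist_nonneg)
  have "\<exists>v\<in>V. (dist x v)\<^sup>2 < d\<^sup>2 + e" if "e > 0" for e
  proof -
    have "d < sqrt (d\<^sup>2 + e)"
      using that \<open>d \<ge> 0\<close> by (simp add: real_less_rsqrt)
    then obtain v where "v \<in> V" "dist x v < sqrt (d\<^sup>2 + e)"
      using \<open>V \<noteq> {}\<close> unfolding d_def infdist_notempty[OF \<open>V \<noteq> {}\<close>]
      by (auto simp: cINF_less_iff)
    moreover have "(sqrt (d\<^sup>2 + e))\<^sup>2 = d\<^sup>2 + e"
      using that by simp
    ultimately show ?thesis
      using power_strict_mono[of "dist x v" "sqrt (d\<^sup>2 + e)" 2] \<open>v \<in> V\<close> \<open>dist x v < _\<close> by force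
  qed
  then have "\<exists>v. \<forall>n. v n \<in> V \<and> (dist x (v n))\<^sup>2 < d\<^sup>2 + 1 / real (Suc n)"
    by (intro choice) (auto simp: Bex_def)
  then obtain v where v: "\<And>n. v n \<in> V" "\<And>n. (dist x (v n))\<^sup>2 < d\<^sup>2 + 1 / real (Suc n)" by blast
  have gap: "(dist (v m) (v n))\<^sup>2 \<le> 2 / real (Suc m) + 2 / real (Suc n)" for m n
  proof -
    have mid: "(1 / 2) *\<^sub>R (v m + v n) \<in> V"
      using V(1) v(1) by (simp add: subspace_add subspace_scale)
    \<comment> \<open>The parallelogram law for \<^term>\<open>x - v m\<close> and \<^term>\<open>x - v n\<close>.\<close>
    have "(dist (v m) (v n))\<^sup>2 = 2 * (dist x (v m))\<^sup>2 + 2 * (dist x (v n))\<^sup>2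
        - 4 * (dist x ((1 / 2) *\<^sub>R (v m + v n)))\<^sup>2"
      by (simp add: dist_norm power2_norm_eq_inner algebra_simps inner_commute)
    moreover have "d\<^sup>2 \<le> (dist x ((1 / 2) *\<^sub>R (v m + v n)))\<^sup>2"
      using d_le[OF mid] \<open>d \<ge> 0\<close> by (rule power_mono)
    ultimately have "(dist (v m) (v n))\<^sup>2 \<le> 2 * (1 / real (Suc m)) + 2 * (1 / real (Suc n))"
      using v(2)[of m] v(2)[of n] by argo
    then show ?thesis by simp
  qed
  have "Cauchy v"
  proof (rule metric_CauchyI)
    fix e :: real assume "0 < e"
    obtain N where N: "inverse (real (Suc N)) < e\<^sup>2 / 4"
      using reals_Archimedean[of "e\<^sup>2 / 4"] \<open>0 < e\<close> by auto
    have "dist (v m) (v n) < e" if "m \<ge> N" "n \<ge> N" for m n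
    proof -
      have "1 / real (Suc k) < e\<^sup>2 / 4" if "k \<ge> N" for k
      proof -
        have "1 / real (Suc k) \<le> 1 / real (Suc N)"
          using that by (intro divide_left_mono) auto
        then show ?thesis using N by (simp add: inverse_eq_divide)
      qed
      from this[OF that(1)] this[OF that(2)] gap[of m n]
      have "(dist (v m) (v n))\<^sup>2 < e\<^sup>2" by linarith
      then show ?thesis using \<open>0 < e\<close> by (simp add: power2_less_imp_less)
    qed
    then show "\<exists>N. \<forall>m\<ge>N. \<forall>n\<ge>N. dist (v m) (v n) < e" by blast
  qed
  then obtain p where p: "v \<longlonglongrightarrow> p"
    by (auto simp: Cauchy_convergent_iff convergent_def)
  show ?thesis
  proof
    show "p \<in> V" using V(2) v(1) p closed_sequentially by blast
    have "(\<lambda>n. d\<^sup>2 + 1 / real (Suc n)) \<longlonglongrightarrow> d\<^sup>2 + 0"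
      by (intro tendsto_intros LIMSEQ_Suc[OF lim_inverse_n'])
    moreover have "(\<lambda>n. (dist x (v n))\<^sup>2) \<longlonglongrightarrow> (dist x p)\<^sup>2"
      by (intro tendsto_intros p)
    ultimately have "(dist x p)\<^sup>2 \<le> d\<^sup>2"
      using v(2) by (intro LIMSEQ_le[where Y = "\<lambda>n. d\<^sup>2 + 1 / real (Suc n)" and X = "\<lambda>n. (dist x (v n))\<^sup>2"])
        (auto intro: less_imp_le)
    then have "dist x p \<le> d"
      using \<open>d \<ge> 0\<close> by (rule power2_le_imp_le)
    then show "dist x p \<le> dist x w" if "w \<in> V" for w
      using d_le[OF that] by linarith
  qed
qed

lemma metric_proj_nearest:
  fixes V :: "'a::{real_inner, complete_space} set"
  assumes V: "subspace V" "closed V"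
  shows "metric_proj V x \<in> V" and "\<forall>v\<in>V. dist x (metric_proj V x) \<le> dist x v"
proof -
  obtain p where "p \<in> V" "\<And>v. v \<in> V \<Longrightarrow> dist x p \<le> dist x v"
    using nearest_point_exists[OF V] by blast
  then have "\<exists>!y. y \<in> V \<and> (\<forall>v\<in>V. dist x y \<le> dist x v)"
    using any_closest_point_unique[OF subspace_imp_convex[OF V(1)] V(2)] by blast
  from theI'[OF this] show "metric_proj V x \<in> V" "\<forall>v\<in>V. dist x (metric_proj V x) \<le> dist x v"
    unfolding metric_proj_def by blast+
qed

text \<open>The variational inequality for the nearest point, tested at \<open>p + v\<close> and at \<open>p - v\<close>, becomes an
  equality on a subspace.\<close>

lemma metric_proj_residual:
  fixes V :: "'a::{real_inner, complete_space} set"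
  assumes V: "subspace V" "closed V"
  shows "x - metric_proj V x \<in> V\<^sup>\<bottom>"
proof (rule orthogonal_compI)
  fix v assume "v \<in> V"
  let ?p = "metric_proj V x"
  note p = metric_proj_nearest[OF V, of x]
  have "(x - ?p) \<bullet> (w - ?p) \<le> 0" if "w \<in> V" for w
    using any_closest_point_dot[OF subspace_imp_convex[OF V(1)] V(2) p(1) that p(2)] .
  from this[of "?p + v"] this[of "?p - v"] show "(x - ?p) \<bullet> v = 0"
    using p(1) \<open>v \<in> V\<close> V(1) by (simp add: subspace_add subspace_diff)
qed

lemma metric_proj_eqI:
  fixes V :: "'a::{real_inner, complete_space} set"
  assumes V: "subspace V" "closed V" and "p \<in> V" "x - p \<in> V\<^sup>\<bottom>"
  shows "metric_proj V x = p"
proof -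
  let ?q = "metric_proj V x"
  have "?q - p \<in> V"
    using V(1) metric_proj_nearest(1)[OF V] \<open>p \<in> V\<close> by (simp add: subspace_diff)
  then have "(x - p) \<bullet> (?q - p) - (x - ?q) \<bullet> (?q - p) = 0"
    using orthogonal_compD[OF metric_proj_residual[OF V, of x]] orthogonal_compD[OF assms(4)]
    by simp
  then have "(?q - p) \<bullet> (?q - p) = 0"
    by (simp flip: inner_diff_left)
  then show ?thesis by simp
qed

lemma linear_metric_proj:
  fixes V :: "'a::{real_inner, complete_space} set"
  assumes V: "subspace V" "closed V"
  shows "linear (metric_proj V)"
proof (rule linearI)
  note p = metric_proj_nearest(1)[OF V] metric_proj_residual[OF V] subspace_orthogonal_comp[of V]
  show "metric_proj V (x + y) = metric_proj V x + metric_proj V y" for x y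
    using p V(1) subspace_add[OF p(3) p(2)[of x] p(2)[of y]]
    by (intro metric_proj_eqI[OF V]) (simp_all add: subspace_add algebra_simps)
  show "metric_proj V (c *\<^sub>R x) = c *\<^sub>R metric_proj V x" for c x
    using p V(1) subspace_scale[OF p(3) p(2)[of x], of c]
    by (intro metric_proj_eqI[OF V]) (simp_all add: subspace_scale algebra_simps)
qed

lemma metric_proj_inner:
  fixes V :: "'a::{real_inner, complete_space} set"
  assumes V: "subspace V" "closed V"
  shows "metric_proj V x \<bullet> y = metric_proj V x \<bullet> metric_proj V y"
  using orthogonal_compD[OF metric_proj_residual[OF V, of y] metric_proj_nearest(1)[OF V, of x]]
  by (simp add: inner_diff_left inner_diff_right inner_commute)

section \<open>The averaged projection operator\<close>

lemma norm_sum_squared_le: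
  fixes x :: "'b \<Rightarrow> 'a::real_normed_vector"
  shows "(norm (\<Sum>i\<in>I. x i))\<^sup>2 \<le> real (card I) * (\<Sum>i\<in>I. (norm (x i))\<^sup>2)"
proof -
  have "(norm (\<Sum>i\<in>I. x i))\<^sup>2 \<le> (\<Sum>i\<in>I. norm (x i))\<^sup>2"
    by (intro power_mono norm_sum) simp
  also have "\<dots> \<le> (\<Sum>i\<in>I. (norm (x i))\<^sup>2) * card I"
    by (rule sum_squared_le_sum_of_squares)
  finally show ?thesis by (simp add: mult.commute)
qed

lemma sum_inner_off_diagonal:
  fixes x :: "'b \<Rightarrow> 'a::real_inner"
  assumes "finite I"
  shows "(\<Sum>i\<in>I. \<Sum>j\<in>I - {i}. x i \<bullet> x j) = (norm (\<Sum>i\<in>I. x i))\<^sup>2 - (\<Sum>i\<in>I. (norm (x i))\<^sup>2)"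
proof -
  have "(\<Sum>j\<in>I - {i}. x i \<bullet> x j) = x i \<bullet> (\<Sum>j\<in>I. x j) - (norm (x i))\<^sup>2" if "i \<in> I" for i
    using assms that by (simp add: sum_diff1 inner_sum_right power2_norm_eq_inner)
  then show ?thesis
    by (simp add: sum_subtractf power2_norm_eq_inner inner_sum_left)
qed

(* Index ranges stay in the form 1..r under simplification. *)
declare One_nat_def [simp del]

locale subspace_family =
  fixes r :: nat and M :: "nat \<Rightarrow> 'a::{real_inner, complete_space} set"
  assumes r_pos: "r \<ge> 1"
    and subspace_M: "\<And>i. i \<in> {1..r} \<Longrightarrow> subspace (M i)"
    and closed_M: "\<And>i. i \<in> {1..r} \<Longrightarrow> closed (M i)"
begin

abbreviation core :: "'a set" where "core \<equiv> \<Inter>i\<in>{1..r}. M i"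
abbreviation P :: "nat \<Rightarrow> 'a \<Rightarrow> 'a" where "P i \<equiv> metric_proj (M i)"
abbreviation T :: "'a \<Rightarrow> 'a" where "T \<equiv> average_proj r M"
abbreviation Q :: "'a \<Rightarrow> 'a" where "Q \<equiv> metric_proj core"
abbreviation perp_sum :: "'a set" where "perp_sum \<equiv> \<Sum>i=1..r. (M i)\<^sup>\<bottom>"

text \<open>The operator \<open>I - T\<close>.  Its kernel is the fixed space of \<open>T\<close>, and its range links \<open>T\<close> to the sum of
  the orthogonal complements.\<close>

definition A :: "'a \<Rightarrow> 'a" where "A x = x - T x"

lemma core: "subspace core" "closed core"
  by (rule subspace_Inter, use subspace_M in blast, rule closed_INT, use closed_M in blast)

lemmas Q_in = metric_proj_nearest(1)[OF core]
  and Q_residual = metric_proj_residual[OF core]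
  and linear_Q = linear_metric_proj[OF core]

lemma P_facts:
  assumes "i \<in> {1..r}"
  shows P_in: "P i x \<in> M i"
    and P_residual: "x - P i x \<in> (M i)\<^sup>\<bottom>"
    and linear_P: "linear (P i)"
    and P_inner: "P i x \<bullet> y = P i x \<bullet> P i y"
  by (rule metric_proj_nearest(1) metric_proj_residual linear_metric_proj metric_proj_inner
      subspace_M[OF assms] closed_M[OF assms])+

lemma linear_T: "linear T"
  by (rule linearI)
     (simp_all add: average_proj_def linear_add[OF linear_P] linear_scale[OF linear_P]
        sum.distrib scaleR_right_distrib scaleR_sum_right mult.commute)

lemma T_self_adjoint: "T x \<bullet> y = x \<bullet> T y"
proof -
  have "P i x \<bullet> y = x \<bullet> P i y" if "i \<in> {1..r}" for i
    using P_inner[OF that, of x y] P_inner[OF that, of y x] by (simp add: inner_commute)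
  then show ?thesis
    by (simp add: average_proj_def inner_sum_left inner_sum_right)
qed

lemma r_T: "real r *\<^sub>R T x = (\<Sum>i=1..r. P i x)"
  using r_pos by (simp add: average_proj_def)

lemma r_T_form: "real r * (T x \<bullet> x) = (\<Sum>i=1..r. (norm (P i x))\<^sup>2)"
proof -
  have "P i x \<bullet> x = (norm (P i x))\<^sup>2" if "i \<in> {1..r}" for i
    using P_inner[OF that, of x x] by (simp add: power2_norm_eq_inner)
  then show ?thesis
    by (simp flip: inner_scaleR_left add: r_T inner_sum_left)
qed

text \<open>So the form of \<open>A\<close> vanishes only on the intersection, and a small value forces \<open>x\<close> to be close to
  every \<open>M i\<close>.\<close>

lemma r_A_form: "real r * (A x \<bullet> x) = (\<Sum>i=1..r. (norm (x - P i x))\<^sup>2)"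
proof -
  have "(norm (x - P i x))\<^sup>2 = (norm x)\<^sup>2 - (norm (P i x))\<^sup>2" if "i \<in> {1..r}" for i
    using P_inner[OF that, of x x]
    by (simp add: power2_norm_eq_inner inner_diff_left inner_diff_right inner_commute)
  then have "(\<Sum>i=1..r. (norm (x - P i x))\<^sup>2) = real r * (norm x)\<^sup>2 - real r * (T x \<bullet> x)"
    by (simp add: sum_subtractf r_T_form)
  then show ?thesis
    by (simp add: A_def inner_diff_left power2_norm_eq_inner right_diff_distrib)
qed

text \<open>The squared norm of an average is at most the average of the squared norms, and
  \<open>(norm (P i x))\<^sup>2 = P i x \<bullet> x\<close>.\<close>

lemma T_firm: "(norm (T x))\<^sup>2 \<le> T x \<bullet> x"
proof -
  have "(real r)\<^sup>2 * (norm (T x))\<^sup>2 = (norm (\<Sum>i=1..r. P i x))\<^sup>2"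
    by (simp flip: r_T add: power_mult_distrib)
  also have "\<dots> \<le> real r * (\<Sum>i=1..r. (norm (P i x))\<^sup>2)"
    using norm_sum_squared_le[of "\<lambda>i. P i x" "{1..r}"] by simp
  also have "\<dots> = (real r)\<^sup>2 * (T x \<bullet> x)"
    unfolding r_T_form[symmetric] by (simp add: power2_eq_square)
  finally show ?thesis using r_pos by simp
qed

text \<open>Firm nonexpansiveness: the norm that \<open>T\<close> keeps and the displacement it causes share the norm
  of \<open>x\<close>.  Summed along an orbit this bounds the total squared displacement, which is where the
  polynomial decay estimates below come from.\<close>

lemma T_A_pythagoras: "(norm (T x))\<^sup>2 + (norm (A x))\<^sup>2 \<le> (norm x)\<^sup>2"
  using T_firm[of x]
  by (simp add: A_def power2_norm_eq_inner inner_diff_left inner_diff_right inner_commute)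

lemma norm_T_le: "norm (T x) \<le> norm x"
  by (rule power2_le_imp_le) (use T_A_pythagoras[of x] zero_le_power2[of "norm (A x)"] in linarith, simp)

lemma norm_A_le: "norm (A x) \<le> norm x"
  by (rule power2_le_imp_le) (use T_A_pythagoras[of x] zero_le_power2[of "norm (T x)"] in linarith, simp)

lemma linear_A: "linear A"
  using linear_compose_sub[OF linear_ident linear_T] by (simp add: A_def[abs_def])

lemma A_T_commute: "A (T x) = T (A x)"
  by (simp add: A_def linear_diff[OF linear_T])

lemma T_core: "x \<in> core \<Longrightarrow> T x = x"
proof -
  assume x: "x \<in> core"
  have "P i x = x" if "i \<in> {1..r}" for i
    using x that by (intro metric_proj_eqI subspace_M closed_M)
      (auto intro: subspace_0[OF subspace_orthogonal_comp])
  then show "T x = x"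
    using r_pos by (simp add: average_proj_def sum_constant_scaleR)
qed

lemma A_eq_0_iff: "A x = 0 \<longleftrightarrow> x \<in> core"
proof
  assume "A x = 0"
  then have "(\<Sum>i=1..r. (norm (x - P i x))\<^sup>2) = 0"
    using r_A_form[of x] by simp
  then have "x = P i x" if "i \<in> {1..r}" for i
    using that by (subst (asm) sum_nonneg_eq_0_iff) auto
  then show "x \<in> core"
    using P_in[of _ x] by (intro INT_I) metis
qed (simp add: A_def T_core)

lemma A_in_perp: "A x \<in> core\<^sup>\<bottom>"
proof (rule orthogonal_compI)
  fix v assume "v \<in> core"
  then show "A x \<bullet> v = 0"
    using T_self_adjoint[of x v] T_core[of v] by (simp add: A_def inner_diff_left)
qed

lemma T_in_perp: "x \<in> core\<^sup>\<bottom> \<Longrightarrow> T x \<in> core\<^sup>\<bottom>"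
  using subspace_diff[OF subspace_orthogonal_comp _ A_in_perp[of x], of x] by (simp add: A_def)

lemma T_pow_in_perp: "x \<in> core\<^sup>\<bottom> \<Longrightarrow> (T ^^ k) x \<in> core\<^sup>\<bottom>"
  by (induction k) (auto simp: T_in_perp)

lemma T_pow_diff: "(T ^^ k) x - Q x = (T ^^ k) (x - Q x)"
proof -
  have "(T ^^ k) (Q x) = Q x"
    using T_core[OF Q_in] by (induction k) simp_all
  then show ?thesis
    by (simp add: linear_diff[OF linear_funpow[OF linear_T]])
qed

lemma norm_residual_le: "norm (x - Q x) \<le> norm x"
proof (rule power2_le_imp_le)
  have "(norm x)\<^sup>2 = (norm (x - Q x))\<^sup>2 + (norm (Q x))\<^sup>2"
    using metric_proj_inner[OF core, of x x]
    by (simp add: power2_norm_eq_inner inner_diff_left inner_diff_right inner_commute)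
  then show "(norm (x - Q x))\<^sup>2 \<le> (norm x)\<^sup>2" by simp
qed simp

lemma Q_perp: "x \<in> core\<^sup>\<bottom> \<Longrightarrow> Q x = 0"
  using core subspace_0[OF core(1)] by (intro metric_proj_eqI) simp_all

text \<open>\<open>A\<close> is self-adjoint, so what is orthogonal to its range is in its kernel, the intersection of
  the subspaces.\<close>

lemma perp_subset_closure_range_A: "core\<^sup>\<bottom> \<subseteq> closure (range A)"
proof
  fix x assume x: "x \<in> core\<^sup>\<bottom>"
  have sub: "subspace (closure (range A))"
    by (intro subspace_closure linear_subspace_image[OF linear_A] subspace_UNIV)
  define p where "p = metric_proj (closure (range A)) x"
  note p = metric_proj_nearest(1)[OF sub closed_closure, of x, folded p_def]
    metric_proj_residual[OF sub closed_closure, of x, folded p_def]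
  have "A (x - p) \<bullet> A (x - p) = (x - p) \<bullet> A (A (x - p))"
    by (simp add: A_def inner_diff_left inner_diff_right T_self_adjoint linear_diff[OF linear_T])
  also have "\<dots> = 0"
    using closure_subset[of "range A"] by (intro orthogonal_compD[OF p(2)]) blast
  finally have "x - p \<in> core"
    by (simp only: inner_eq_zero_iff A_eq_0_iff)
  moreover have "closure (range A) \<subseteq> core\<^sup>\<bottom>"
    using A_in_perp by (intro closure_minimal closed_orthogonal_comp) auto
  then have "x - p \<in> core\<^sup>\<bottom>"
    using x p(1) subspace_diff[OF subspace_orthogonal_comp] by blast
  ultimately have "(x - p) \<bullet> (x - p) = 0" by (intro orthogonal_compD)
  then show "x \<in> closure (range A)" using p(1) by simp
qed

lemma A_residual: "A (x - Q x) = A x"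
  using A_eq_0_iff[of "Q x"] Q_in by (simp add: linear_diff[OF linear_A])

lemma perp_subset_closure_A_perp: "core\<^sup>\<bottom> \<subseteq> closure (A ` (core\<^sup>\<bottom>))"
proof -
  have "range A \<subseteq> A ` (core\<^sup>\<bottom>)"
  proof clarify
    fix x
    show "A x \<in> A ` (core\<^sup>\<bottom>)"
      using imageI[OF Q_residual, of A x] by (simp only: A_residual)
  qed
  from order_trans[OF perp_subset_closure_range_A closure_mono[OF this]] show ?thesis .
qed

lemma T_pow_A_sum: "(\<Sum>j<k. (norm (A ((T ^^ j) x)))\<^sup>2) + (norm ((T ^^ k) x))\<^sup>2 \<le> (norm x)\<^sup>2"
proof (induction k)
  case (Suc k)
  then show ?case using T_A_pythagoras[of "(T ^^ k) x"] by simp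
qed simp

lemma A_T_pow_commute: "A ((T ^^ k) x) = (T ^^ k) (A x)"
  by (induction k) (simp_all add: A_T_commute)

lemma norm_T_pow_antimono:
  assumes "j \<le> k" shows "norm ((T ^^ k) x) \<le> norm ((T ^^ j) x)"
proof -
  have "(T ^^ k) x = (T ^^ (k - j)) ((T ^^ j) x)"
    using assms by (simp flip: funpow_add[THEN fun_cong, unfolded o_apply])
  then show ?thesis using norm_funpow_le[of T, OF norm_T_le] by simp
qed

text \<open>The squared displacements \<open>(norm (A ((T ^^ j) x)))\<^sup>2\<close> are nonincreasing in \<open>j\<close> and have sum at most
  \<open>(norm x)\<^sup>2\<close>.\<close>

lemma T_pow_A_decay: "real (Suc k) * (norm ((T ^^ k) (A x)))\<^sup>2 \<le> (norm x)\<^sup>2"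
proof -
  have "real (Suc k) * (norm ((T ^^ k) (A x)))\<^sup>2 = (\<Sum>j<Suc k. (norm ((T ^^ k) (A x)))\<^sup>2)"
    by simp
  also have "\<dots> \<le> (\<Sum>j<Suc k. (norm ((T ^^ j) (A x)))\<^sup>2)"
    by (intro sum_mono power_mono norm_T_pow_antimono) auto
  also have "\<dots> \<le> (norm x)\<^sup>2"
    using T_pow_A_sum[of x "Suc k"] unfolding A_T_pow_commute
    using zero_le_power2[of "norm ((T ^^ Suc k) x)"] by linarith
  finally show ?thesis .
qed

lemma T_pow_A_null: "(\<lambda>k. norm ((T ^^ k) (A x))) \<longlonglongrightarrow> 0"
proof -
  have "(\<lambda>k. (norm ((T ^^ k) (A x)))\<^sup>2) \<longlonglongrightarrow> 0"
  proof (rule tendsto_sandwich[of "\<lambda>_. 0" _ _ "\<lambda>k. (norm x)\<^sup>2 * (1 / real (Suc k))"])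
    have "(\<lambda>k. (norm x)\<^sup>2 * (1 / real (Suc k))) \<longlonglongrightarrow> (norm x)\<^sup>2 * 0"
      by (intro tendsto_intros LIMSEQ_Suc[OF lim_inverse_n'])
    then show "(\<lambda>k. (norm x)\<^sup>2 * (1 / real (Suc k))) \<longlonglongrightarrow> 0" by simp
    show "\<forall>\<^sub>F k in sequentially. (norm ((T ^^ k) (A x)))\<^sup>2 \<le> (norm x)\<^sup>2 * (1 / real (Suc k))"
      using T_pow_A_decay[of _ x] by (intro always_eventually allI) (simp add: field_simps)
  qed auto
  then show ?thesis
    using tendsto_real_sqrt[of "\<lambda>k. (norm ((T ^^ k) (A x)))\<^sup>2" 0] by simp
qed

text \<open>On the range of \<open>A\<close> the iterates tend to zero; as they are uniformly bounded, this extends to the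
  closure of the range, which contains every residual \<open>x - Q x\<close>.\<close>

lemma T_iterates_converge: "iterates_converge T Q"
  unfolding iterates_converge_def
proof
  fix x
  have "(\<lambda>k. norm ((T ^^ k) x - Q x)) \<longlonglongrightarrow> 0"
  proof (rule tendstoI)
    fix e :: real assume "0 < e"
    have "x - Q x \<in> closure (range A)"
      using Q_residual perp_subset_closure_range_A by blast
    then obtain z where z: "dist (A z) (x - Q x) < e / 2"
      using \<open>0 < e\<close> unfolding closure_approachable by (auto dest!: spec[of _ "e / 2"])
    have "\<forall>\<^sub>F k in sequentially. norm ((T ^^ k) (A z)) < e / 2"
      using T_pow_A_null \<open>0 < e\<close> by (intro order_tendstoD(2)[where y=0]) simp_all
    then show "\<forall>\<^sub>F k in sequentially. dist (norm ((T ^^ k) x - Q x)) 0 < e"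
    proof eventually_elim
      case (elim k)
      have "(T ^^ k) x - Q x = (T ^^ k) (x - Q x - A z) + (T ^^ k) (A z)"
        by (simp add: T_pow_diff flip: linear_add[OF linear_funpow[OF linear_T]])
      moreover have "norm ((T ^^ k) (x - Q x - A z)) \<le> dist (A z) (x - Q x)"
        using norm_funpow_le[of T k "x - Q x - A z", OF norm_T_le]
        by (simp add: dist_norm norm_minus_commute)
      ultimately show ?case
        using norm_triangle_ineq[of "(T ^^ k) (x - Q x - A z)" "(T ^^ k) (A z)"] elim z by simp
    qed
  qed
  then show "(\<lambda>k. (T ^^ k) x) \<longlonglongrightarrow> Q x"
    by (simp add: tendsto_norm_zero_iff LIM_zero_iff)
qed

section \<open>Closed sum of complements: linear convergence\<close>

lemma perp_sum_iff: "x \<in> perp_sum \<longleftrightarrow> (\<exists>z. (\<forall>i\<in>{1..r}. z i \<in> (M i)\<^sup>\<bottom>) \<and> x = (\<Sum>i=1..r. z i))"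
  by (subst set_sum_alt) auto

lemma perp_sum_subset: "perp_sum \<subseteq> core\<^sup>\<bottom>"
proof
  fix x assume "x \<in> perp_sum"
  then obtain z where z: "\<forall>i\<in>{1..r}. z i \<in> (M i)\<^sup>\<bottom>" "x = (\<Sum>i=1..r. z i)"
    unfolding perp_sum_iff by blast
  have "z i \<in> core\<^sup>\<bottom>" if "i \<in> {1..r}" for i
    using z(1) that orthogonal_comp_anti_mono[of core "M i"] by blast
  then show "x \<in> core\<^sup>\<bottom>"
    unfolding z(2) by (intro subspace_sum subspace_orthogonal_comp)
qed

lemma range_A_subset: "range A \<subseteq> perp_sum"
proof clarify
  fix x
  have "A x = (\<Sum>i=1..r. (1 / real r) *\<^sub>R (x - P i x))"
    using r_pos by (simp add: A_def average_proj_def sum_subtractf scaleR_right_diff_distrib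
        scaleR_sum_right sum_constant_scaleR)
  moreover have "(1 / real r) *\<^sub>R (x - P i x) \<in> (M i)\<^sup>\<bottom>" if "i \<in> {1..r}" for i
    using P_residual[OF that] by (simp add: subspace_scale[OF subspace_orthogonal_comp])
  ultimately show "A x \<in> perp_sum"
    unfolding perp_sum_iff by (intro exI[of _ "\<lambda>i. (1 / real r) *\<^sub>R (x - P i x)"]) blast
qed

text \<open>The sum of the complements lies between the range of \<open>A\<close> and the closure of that range.\<close>

lemma closed_perp_sum_iff: "closed perp_sum \<longleftrightarrow> perp_sum = core\<^sup>\<bottom>"
proof
  assume "closed perp_sum"
  then have "closure (range A) \<subseteq> perp_sum"
    using range_A_subset by (rule closure_minimal[rotated])
  then show "perp_sum = core\<^sup>\<bottom>"
    using perp_subset_closure_range_A perp_sum_subset by blast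
qed (metis closed_orthogonal_comp)

text \<open>If the bound fails, there are unit vectors \<open>u n\<close> on which the form of \<open>A\<close> decays like \<open>(1 / 16) ^ n\<close>.  Then
  \<open>u n\<close> is within \<open>(1 / 4) ^ n\<close> of each \<open>M i\<close>, so its inner product with any sum of elements of the
  complements is of order \<open>(1 / 4) ^ n\<close>.  The gliding hump produces a vector in the orthogonal complement
  of the intersection whose inner products with \<open>u n\<close> decay only like \<open>(1 / 3) ^ n\<close>.  If the sum is
  closed, that vector is such a sum, a contradiction.\<close>

lemma closed_imp_coercive:
  assumes "closed perp_sum"
  shows "\<exists>\<delta>>0. \<forall>x\<in>core\<^sup>\<bottom>. \<delta> * (norm x)\<^sup>2 \<le> A x \<bullet> x"
proof (rule ccontr)
  assume "\<not> ?thesis"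
  then have no: "\<exists>x\<in>core\<^sup>\<bottom>. A x \<bullet> x < \<delta> * (norm x)\<^sup>2" if "\<delta> > 0" for \<delta>
    using that by (meson not_le)
  (* With the factor 1 / r, the form of A bounds every single squared distance by (1 / 16) ^ n. *)
  define \<delta> where "\<delta> n = (1 / 16) ^ n / real r" for n
  have \<delta>: "\<delta> n > 0" for n using r_pos by (simp add: \<delta>_def)
  have "\<exists>u. norm u = 1 \<and> u \<in> core\<^sup>\<bottom> \<and> A u \<bullet> u < \<delta> n" for n
  proof -
    obtain x where x: "x \<in> core\<^sup>\<bottom>" "A x \<bullet> x < \<delta> n * (norm x)\<^sup>2"
      using no[OF \<delta>] by blast
    then have "x \<noteq> 0" using linear_0[OF linear_A] by auto
    let ?u = "(1 / norm x) *\<^sub>R x"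
    have "A ?u \<bullet> ?u = (A x \<bullet> x) / (norm x)\<^sup>2"
      by (simp add: linear_scale[OF linear_A] power2_eq_square)
    also have "\<dots> < \<delta> n" using x(2) \<open>x \<noteq> 0\<close> by (simp add: divide_simps)
    finally show ?thesis
      using x(1) \<open>x \<noteq> 0\<close> by (intro exI[of _ ?u])
        (simp add: subspace_scale[OF subspace_orthogonal_comp])
  qed
  then obtain u where u: "\<And>n. norm (u n) = 1" "\<And>n. u n \<in> core\<^sup>\<bottom>" "\<And>n. A (u n) \<bullet> u n < \<delta> n"
    by metis
  have small: "norm (u n - P i (u n)) \<le> (1 / 4) ^ n" if "i \<in> {1..r}" for i n
  proof (rule power2_le_imp_le)
    have "(norm (u n - P i (u n)))\<^sup>2 \<le> (\<Sum>i=1..r. (norm (u n - P i (u n)))\<^sup>2)"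
      using that by (intro member_le_sum) auto
    also have "\<dots> = real r * (A (u n) \<bullet> u n)" by (rule r_A_form[symmetric])
    also have "\<dots> \<le> real r * \<delta> n"
      using u(3)[of n] by (intro mult_left_mono) auto
    also have "\<dots> = ((1 / 4) ^ n)\<^sup>2"
      using r_pos by (simp add: \<delta>_def power2_eq_square flip: power_mult_distrib)
    finally show "(norm (u n - P i (u n)))\<^sup>2 \<le> ((1 / 4) ^ n)\<^sup>2" .
  qed simp
  obtain x where x: "x \<in> core\<^sup>\<bottom>" "\<And>n. (1 / 3) ^ n / 4 \<le> norm (u n \<bullet> x)"
  proof (rule gliding_hump[of "core\<^sup>\<bottom>" "\<lambda>n x. u n \<bullet> x" u])
    show "norm (u n \<bullet> x) \<le> norm x" for n x
      using Cauchy_Schwarz_ineq2[of "u n" x] u(1) by simp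
    show "3 / 4 \<le> norm (u n \<bullet> u n)" for n
      using u(1)[of n] by (simp flip: power2_norm_eq_inner)
  qed (use u in \<open>simp_all add: closed_orthogonal_comp subspace_orthogonal_comp
      bounded_linear.linear[OF bounded_linear_inner_right]\<close>)
  then obtain z where z: "\<And>i. i \<in> {1..r} \<Longrightarrow> z i \<in> (M i)\<^sup>\<bottom>" "x = (\<Sum>i=1..r. z i)"
    using assms unfolding closed_perp_sum_iff by (metis perp_sum_iff)
  define C where "C = (\<Sum>i=1..r. norm (z i))"
  have upper: "norm (u n \<bullet> x) \<le> (1 / 4) ^ n * C" for n
  proof -
    have "norm (u n \<bullet> x) \<le> (\<Sum>i=1..r. norm (u n \<bullet> z i))"
      unfolding z(2) inner_sum_right by (rule norm_sum)
    also have "\<dots> \<le> (\<Sum>i=1..r. (1 / 4) ^ n * norm (z i))"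
    proof (rule sum_mono)
      fix i assume i: "i \<in> {1..r}"
      have "u n \<bullet> z i = (u n - P i (u n)) \<bullet> z i"
        using orthogonal_compD[OF z(1)[OF i] P_in[OF i, of "u n"]]
        by (simp add: inner_diff_left inner_diff_right inner_commute)
      also have "norm \<dots> \<le> norm (u n - P i (u n)) * norm (z i)"
        using Cauchy_Schwarz_ineq2 by simp
      also have "\<dots> \<le> (1 / 4) ^ n * norm (z i)"
        using small[OF i] by (intro mult_right_mono) auto
      finally show "norm (u n \<bullet> z i) \<le> (1 / 4) ^ n * norm (z i)" .
    qed
    finally show ?thesis by (simp add: C_def sum_distrib_left)
  qed
  obtain n where n: "4 * C < (4 / 3) ^ n"
    using real_arch_pow[of "4 / 3" "4 * C"] by auto
  have "(1 / 3) ^ n / 4 \<le> (1 / 4) ^ n * C"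
    using x(2)[of n] upper[of n] by linarith
  then have "(4 / 3 :: real) ^ n \<le> 4 * C"
    by (simp add: power_divide field_simps)
  then show False using n by simp
qed

lemma closed_imp_contraction:
  assumes "closed perp_sum"
  obtains c where "0 < c" "c < 1" and "\<And>x. x \<in> core\<^sup>\<bottom> \<Longrightarrow> norm (T x) \<le> c * norm x"
proof -
  obtain \<delta> where \<delta>: "\<delta> > 0" "\<And>x. x \<in> core\<^sup>\<bottom> \<Longrightarrow> \<delta> * (norm x)\<^sup>2 \<le> A x \<bullet> x"
    using closed_imp_coercive[OF assms] by blast
  (* The maximum keeps c positive when the form bound is at least 1. *)
  define c where "c = sqrt (max (1 / 2) (1 - \<delta>))"
  have c: "0 < c" "c < 1" using \<delta>(1) by (auto simp: c_def less_max_iff_disj)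
  have "norm (T x) \<le> c * norm x" if "x \<in> core\<^sup>\<bottom>" for x
  proof (rule power2_le_imp_le)
    have "(norm (T x))\<^sup>2 \<le> (norm x)\<^sup>2 - A x \<bullet> x"
      using T_firm[of x] by (simp add: A_def inner_diff_left power2_norm_eq_inner)
    also have "\<dots> \<le> (1 - \<delta>) * (norm x)\<^sup>2"
      using \<delta>(2)[OF that] by (simp add: algebra_simps)
    also have "\<dots> \<le> c\<^sup>2 * (norm x)\<^sup>2"
      by (intro mult_right_mono) (auto simp: c_def)
    finally show "(norm (T x))\<^sup>2 \<le> (c * norm x)\<^sup>2"
      by (simp add: power_mult_distrib)
  qed (use c in simp)
  with c that show ?thesis by blast
qed

lemma contraction_rate:
  assumes "0 \<le> c" and T: "\<And>x. x \<in> core\<^sup>\<bottom> \<Longrightarrow> norm (T x) \<le> c * norm x"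
  shows "norm ((T ^^ k) x - Q x) \<le> c ^ k * norm x"
proof -
  have "norm ((T ^^ k) y) \<le> c ^ k * norm y" if y: "y \<in> core\<^sup>\<bottom>" for y
  proof (induction k)
    case (Suc k)
    have "norm (T ((T ^^ k) y)) \<le> c * norm ((T ^^ k) y)"
      by (rule T[OF T_pow_in_perp[OF y]])
    also have "\<dots> \<le> c * (c ^ k * norm y)"
      using Suc \<open>0 \<le> c\<close> by (rule mult_left_mono)
    finally show ?case by (simp add: mult.assoc)
  qed simp
  from this[OF Q_residual] have "norm ((T ^^ k) x - Q x) \<le> c ^ k * norm (x - Q x)"
    unfolding T_pow_diff .
  also have "\<dots> \<le> c ^ k * norm x"
    using norm_residual_le \<open>0 \<le> c\<close> by (intro mult_left_mono) auto
  finally show ?thesis .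
qed

lemma closed_imp_converges_linearly:
  assumes "closed perp_sum"
  shows "converges_linearly T Q"
proof -
  obtain c where "0 < c" "c < 1" "\<And>x. x \<in> core\<^sup>\<bottom> \<Longrightarrow> norm (T x) \<le> c * norm x"
    using closed_imp_contraction[OF assms] by blast
  then show ?thesis
    unfolding converges_linearly_def using T_iterates_converge contraction_rate[of c]
    by (intro conjI exI[of _ "1::real"] exI[of _ c]) auto
qed

section \<open>The Friedrichs number and the optimal rate\<close>

text \<open>Together with the converse below this says that the synthesis map \<open>(x i) \<mapsto> \<Sum> x i\<close>, on families
  with \<open>x i\<close> in \<open>M i\<close> and orthogonal to the intersection, has squared norm \<open>r\<close> times the
  norm of \<open>T\<close> on the complement of the intersection: \<open>r T\<close> is the product of this map with its adjoint
  \<open>s \<mapsto> (P i s)\<close>.\<close>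

lemma gram_bound:
  assumes "0 \<le> c" and T: "\<And>x. x \<in> core\<^sup>\<bottom> \<Longrightarrow> norm (T x) \<le> c * norm x"
    and x: "\<And>i. i \<in> {1..r} \<Longrightarrow> x i \<in> M i \<inter> core\<^sup>\<bottom>"
  shows "(norm (\<Sum>i=1..r. x i))\<^sup>2 \<le> real r * c * (\<Sum>i=1..r. (norm (x i))\<^sup>2)"
proof -
  define s where "s = (\<Sum>i=1..r. x i)"
  define S where "S = (\<Sum>i=1..r. (norm (x i))\<^sup>2)"
  have s: "s \<in> core\<^sup>\<bottom>"
    unfolding s_def using x by (intro subspace_sum subspace_orthogonal_comp) auto
  have "x i \<bullet> s = x i \<bullet> P i s" if "i \<in> {1..r}" for i
    using orthogonal_compD[OF P_residual[OF that, of s], of "x i"] x[OF that]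
    by (simp add: inner_diff_left inner_diff_right inner_commute)
  then have "(\<Sum>i=1..r. x i \<bullet> s) = (\<Sum>i=1..r. x i \<bullet> P i s)"
    by (intro sum.cong) auto
  then have "(norm s)\<^sup>2 = (\<Sum>i=1..r. x i \<bullet> P i s)"
    by (simp add: power2_norm_eq_inner flip: inner_sum_left s_def)
  also have "\<dots> \<le> (\<Sum>i=1..r. norm (x i) * norm (P i s))"
    by (intro sum_mono norm_cauchy_schwarz)
  finally have "((norm s)\<^sup>2)\<^sup>2 \<le> (\<Sum>i=1..r. norm (x i) * norm (P i s))\<^sup>2"
    by (intro power_mono) auto
  also have "\<dots> \<le> S * (\<Sum>i=1..r. (norm (P i s))\<^sup>2)"
    unfolding S_def by (rule Cauchy_Schwarz_ineq_sum)
  also have "\<dots> = S * (real r * (T s \<bullet> s))" by (simp only: r_T_form)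
  also have "\<dots> \<le> S * (real r * (c * (norm s)\<^sup>2))"
  proof (intro mult_left_mono)
    have "T s \<bullet> s \<le> norm (T s) * norm s" by (rule norm_cauchy_schwarz)
    also have "\<dots> \<le> c * norm s * norm s" using T[OF s] by (intro mult_right_mono) auto
    finally show "T s \<bullet> s \<le> c * (norm s)\<^sup>2" by (simp add: power2_eq_square)
  qed (auto simp: S_def sum_nonneg)
  finally have *: "(norm s)\<^sup>2 * (norm s)\<^sup>2 \<le> (real r * c * S) * (norm s)\<^sup>2"
    by (simp add: power2_eq_square mult_ac)
  have "(norm s)\<^sup>2 \<le> real r * c * S"
  proof (cases "s = 0")
    case False
    then show ?thesis using mult_right_le_imp_le[OF *] by simp
  next
    case True
    then show ?thesis using \<open>0 \<le> c\<close> by (simp add: S_def sum_nonneg)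
  qed
  then show ?thesis by (simp only: s_def S_def)
qed

lemma contraction_of_gram_bound:
  assumes "0 \<le> c" and gram: "\<And>x. (\<And>i. i \<in> {1..r} \<Longrightarrow> x i \<in> M i \<inter> core\<^sup>\<bottom>) \<Longrightarrow>
      (norm (\<Sum>i=1..r. x i))\<^sup>2 \<le> real r * c * (\<Sum>i=1..r. (norm (x i))\<^sup>2)"
    and y: "y \<in> core\<^sup>\<bottom>"
  shows "norm (T y) \<le> c * norm y"
proof -
  have "P i y \<in> M i \<inter> core\<^sup>\<bottom>" if i: "i \<in> {1..r}" for i
  proof
    show "P i y \<in> core\<^sup>\<bottom>"
    proof (rule orthogonal_compI)
      fix v assume v: "v \<in> core"
      then have "(y - P i y) \<bullet> v = 0"
        using P_residual[OF i] i by (intro orthogonal_compD) auto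
      then show "P i y \<bullet> v = 0"
        using orthogonal_compD[OF y v] by (simp add: inner_diff_left)
    qed
  qed (rule P_in[OF i])
  from gram[OF this] have "(real r)\<^sup>2 * (norm (T y))\<^sup>2 \<le> (real r)\<^sup>2 * (c * (T y \<bullet> y))"
    by (simp flip: r_T r_T_form add: power_mult_distrib) (simp add: power2_eq_square mult_ac)
  then have "(norm (T y))\<^sup>2 \<le> c * (T y \<bullet> y)"
    using r_pos by simp
  also have "\<dots> \<le> c * (norm (T y) * norm y)"
    using \<open>0 \<le> c\<close> by (intro mult_left_mono norm_cauchy_schwarz)
  finally have "norm (T y) * norm (T y) \<le> norm (T y) * (c * norm y)"
    by (simp add: power2_eq_square mult_ac)
  then show ?thesis
    using \<open>0 \<le> c\<close> by (cases "T y = 0") auto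
qed

text \<open>The set whose supremum is the Friedrichs number, with the off-diagonal sum written as
  \<open>(norm (\<Sum> x i))\<^sup>2\<close> minus its diagonal.\<close>

definition friedrichs_ratios :: "real set" where
  "friedrichs_ratios =
     {((norm (\<Sum>i=1..r. x i))\<^sup>2 - (\<Sum>i=1..r. (norm (x i))\<^sup>2)) / ((real r - 1) * (\<Sum>i=1..r. (norm (x i))\<^sup>2)) | x.
      (\<forall>i\<in>{1..r}. x i \<in> M i \<inter> core\<^sup>\<bottom>) \<and> (\<Sum>i=1..r. (norm (x i))\<^sup>2) \<noteq> 0}"

lemma friedrichs_number_eq: "friedrichs_number r M = Sup friedrichs_ratios"
  unfolding friedrichs_number_def friedrichs_ratios_def
  by (simp add: sum_inner_off_diagonal)

lemma friedrichs_ratio_le: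
  assumes "r \<ge> 2" "0 \<le> c" and T: "\<And>x. x \<in> core\<^sup>\<bottom> \<Longrightarrow> norm (T x) \<le> c * norm x"
    and "f \<in> friedrichs_ratios"
  shows "f \<le> (real r * c - 1) / (real r - 1)"
proof -
  obtain x where x: "\<And>i. i \<in> {1..r} \<Longrightarrow> x i \<in> M i \<inter> core\<^sup>\<bottom>"
      and nz: "(\<Sum>i=1..r. (norm (x i))\<^sup>2) \<noteq> 0"
      and f: "f = ((norm (\<Sum>i=1..r. x i))\<^sup>2 - (\<Sum>i=1..r. (norm (x i))\<^sup>2))
        / ((real r - 1) * (\<Sum>i=1..r. (norm (x i))\<^sup>2))"
    using assms(4) unfolding friedrichs_ratios_def by blast
  define S where "S = (\<Sum>i=1..r. (norm (x i))\<^sup>2)"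
  have "S > 0" using nz by (simp add: S_def sum_nonneg less_le)
  have "(norm (\<Sum>i=1..r. x i))\<^sup>2 - S \<le> (real r * c - 1) * S"
    using gram_bound[OF \<open>0 \<le> c\<close> T x] by (simp add: S_def algebra_simps)
  then have "f \<le> ((real r * c - 1) * S) / ((real r - 1) * S)"
    unfolding f S_def[symmetric] using \<open>S > 0\<close> \<open>r \<ge> 2\<close> by (intro divide_right_mono) auto
  then show ?thesis using \<open>S > 0\<close> by simp
qed

text \<open>A family with a single nonzero member has no off-diagonal terms.  It exists as soon as some \<open>M k\<close>
  is strictly larger than the intersection.\<close>

lemma zero_in_friedrichs_ratios:
  assumes "i \<in> {1..r}" "j \<in> {1..r}" "M i \<noteq> M j"
  shows "0 \<in> friedrichs_ratios"
proof -
  obtain k where k: "k \<in> {1..r}" "M k \<noteq> core"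
    using assms by metis
  then have "core \<subset> M k" by blast
  then obtain y where y: "y \<in> M k" "y \<notin> core" by blast
  define z where "z = y - Q y"
  have "Q y \<in> M k" using Q_in[of y] k(1) by blast
  then have "z \<in> M k"
    using y(1) subspace_M[OF k(1)] by (simp add: z_def subspace_diff)
  moreover have "z \<in> core\<^sup>\<bottom>" unfolding z_def by (rule Q_residual)
  moreover have "z \<noteq> 0" using y(2) Q_in[of y] by (metis z_def right_minus_eq)
  ultimately have z: "z \<in> M k" "z \<in> core\<^sup>\<bottom>" "z \<noteq> 0" .
  define x where "x i = (if i = k then z else 0)" for i
  have "x i \<in> M i \<inter> core\<^sup>\<bottom>" if "i \<in> {1..r}" for i
    using z subspace_0[OF subspace_M[OF that]] subspace_0[OF subspace_orthogonal_comp[of core]]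
    by (simp add: x_def)
  moreover have "(\<Sum>i=1..r. x i) = z"
    using k(1) by (simp add: x_def)
  moreover have "(\<Sum>i=1..r. (norm (x i))\<^sup>2) = (norm z)\<^sup>2"
    using k(1) by (simp add: x_def if_distrib[of norm] if_distrib[of "\<lambda>t. t\<^sup>2"] cong: if_cong)
  ultimately show ?thesis
    using z(3) unfolding friedrichs_ratios_def by (intro CollectI exI[of _ x]) simp
qed

text \<open>The affine map \<open>f \<mapsto> (r - 1) / r * f + 1 / r\<close> turns a Friedrichs ratio into the quotient of
  \<open>(norm (\<Sum> x i))\<^sup>2\<close> and \<open>r * (\<Sum> (norm (x i))\<^sup>2)\<close>.  By the two Gram bounds, \<open>q\<close> is then the norm of \<open>T\<close> on the
  complement of the intersection, and the first iterate already forces every admissible rate to be at least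
  this norm.\<close>

lemma friedrichs_rate_optimal:
  assumes "r \<ge> 2" "closed perp_sum" and distinct: "i \<in> {1..r}" "j \<in> {1..r}" "M i \<noteq> M j"
  defines "q \<equiv> (real r - 1) / real r * friedrichs_number r M + 1 / real r"
  shows "q \<in> linear_rates T Q" and "\<forall>q'\<in>linear_rates T Q. q \<le> q'"
proof -
  have zero: "0 \<in> friedrichs_ratios" by (rule zero_in_friedrichs_ratios[OF distinct])
  have bdd: "bdd_above friedrichs_ratios"
    using friedrichs_ratio_le[of 1] \<open>r \<ge> 2\<close> norm_T_le by (intro bdd_aboveI) auto
  have q_le: "q \<le> c" if "0 \<le> c" "\<And>x. x \<in> core\<^sup>\<bottom> \<Longrightarrow> norm (T x) \<le> c * norm x" for c
  proof -
    have "friedrichs_number r M \<le> (real r * c - 1) / (real r - 1)"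
      unfolding friedrichs_number_eq
      using zero friedrichs_ratio_le[OF \<open>r \<ge> 2\<close> that] by (intro cSup_least) auto
    then have "q \<le> (real r - 1) / real r * ((real r * c - 1) / (real r - 1)) + 1 / real r"
      unfolding q_def using \<open>r \<ge> 2\<close> by (intro add_right_mono mult_left_mono) auto
    also have "\<dots> = c" using \<open>r \<ge> 2\<close> by (simp add: field_simps)
    finally show ?thesis .
  qed
  have "0 \<le> friedrichs_number r M"
    unfolding friedrichs_number_eq using zero bdd by (rule cSup_upper)
  then have "q > 0"
    unfolding q_def using \<open>r \<ge> 2\<close> by (intro add_nonneg_pos mult_nonneg_nonneg) auto
  have "norm (T y) \<le> q * norm y" if "y \<in> core\<^sup>\<bottom>" for y
  proof (rule contraction_of_gram_bound[OF _ _ that])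
    fix x assume x: "\<And>i. i \<in> {1..r} \<Longrightarrow> x i \<in> M i \<inter> core\<^sup>\<bottom>"
    define S where "S = (\<Sum>i=1..r. (norm (x i))\<^sup>2)"
    have "(norm (\<Sum>i=1..r. x i))\<^sup>2 \<le> real r * q * S"
    proof (cases "S = 0")
      case True
      then have "x i = 0" if "i \<in> {1..r}" for i
        using that unfolding S_def by (subst (asm) sum_nonneg_eq_0_iff) auto
      then show ?thesis using True by simp
    next
      case False
      then have "S > 0" by (simp add: S_def sum_nonneg less_le)
      have "((norm (\<Sum>i=1..r. x i))\<^sup>2 - S) / ((real r - 1) * S) \<le> friedrichs_number r M"
        unfolding friedrichs_number_eq
        using x False by (intro cSup_upper bdd) (auto simp: friedrichs_ratios_def S_def)
      then have "(norm (\<Sum>i=1..r. x i))\<^sup>2 \<le> S * ((real r - 1) * friedrichs_number r M + 1)"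
        using \<open>S > 0\<close> \<open>r \<ge> 2\<close> by (simp add: divide_le_eq algebra_simps)
      also have "\<dots> = real r * q * S"
        using \<open>r \<ge> 2\<close> by (simp add: q_def field_simps)
      finally show ?thesis .
    qed
    then show "(norm (\<Sum>i=1..r. x i))\<^sup>2 \<le> real r * q * (\<Sum>i=1..r. (norm (x i))\<^sup>2)"
      by (simp only: S_def)
  qed (use \<open>q > 0\<close> in simp)
  note rate = contraction_rate[OF less_imp_le[OF \<open>q > 0\<close>] this]
  obtain c where "0 < c" "c < 1" "\<And>x. x \<in> core\<^sup>\<bottom> \<Longrightarrow> norm (T x) \<le> c * norm x"
    using closed_imp_contraction[OF \<open>closed perp_sum\<close>] by blast
  then have "q < 1" using q_le[of c] by auto
  then show "q \<in> linear_rates T Q"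
    unfolding linear_rates_def using \<open>q > 0\<close> rate by blast
  show "\<forall>q'\<in>linear_rates T Q. q \<le> q'"
  proof
    fix q' assume "q' \<in> linear_rates T Q"
    then have q': "0 < q'" "norm ((T ^^ k) x - Q x) \<le> q' ^ k * norm x" for x k
      by (auto simp: linear_rates_def)
    show "q \<le> q'"
    proof (rule q_le)
      show "norm (T x) \<le> q' * norm x" if "x \<in> core\<^sup>\<bottom>" for x
        using q'(2)[of "Suc 0" x] Q_perp[OF that] by simp
    qed (use q'(1) in simp)
  qed
qed

section \<open>Non-closed sum of complements: arbitrarily slow convergence\<close>

text \<open>Otherwise \<open>T ^^ k\<close> is a strict contraction of the complement of the intersection.  Banach's fixed point
  theorem then solves \<open>x = z - (T ^^ k) z\<close> there, and this difference factors through \<open>A\<close>, so every such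
  \<open>x\<close> is in the sum of the complements.\<close>

lemma nonclosed_imp_slow_vector:
  assumes "\<not> closed perp_sum"
  shows "\<exists>u\<in>core\<^sup>\<bottom>. norm u \<le> 1 \<and> 3 / 4 \<le> norm ((T ^^ k) u)"
proof (rule ccontr)
  assume "\<not> ?thesis"
  then have small: "norm ((T ^^ k) u) < 3 / 4" if "u \<in> core\<^sup>\<bottom>" "norm u \<le> 1" for u
    using that by (meson not_le)
  have contr: "norm ((T ^^ k) x) \<le> 3 / 4 * norm x" if x: "x \<in> core\<^sup>\<bottom>" for x
  proof (cases "x = 0")
    case False
    have "norm ((T ^^ k) ((1 / norm x) *\<^sub>R x)) < 3 / 4"
      using False x by (intro small) (simp_all add: subspace_scale[OF subspace_orthogonal_comp])
    then show ?thesis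
      using False by (simp add: linear_scale[OF linear_funpow[OF linear_T]] divide_simps mult_ac)
  qed (simp add: linear_0[OF linear_funpow[OF linear_T]])
  have "core\<^sup>\<bottom> \<subseteq> perp_sum"
  proof
    fix x assume x: "x \<in> core\<^sup>\<bottom>"
    have "\<exists>!z. z \<in> core\<^sup>\<bottom> \<and> x + (T ^^ k) z = z"
    proof (rule Banach_fix[of _ "3 / 4"])
      show "complete (core\<^sup>\<bottom>)"
        using closed_orthogonal_comp by (simp add: complete_eq_closed)
      show "(\<lambda>z. x + (T ^^ k) z) ` (core\<^sup>\<bottom>) \<subseteq> core\<^sup>\<bottom>"
        using x T_pow_in_perp subspace_add[OF subspace_orthogonal_comp] by blast
      show "dist (x + (T ^^ k) y) (x + (T ^^ k) z) \<le> 3 / 4 * dist y z"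
        if "y \<in> core\<^sup>\<bottom>" "z \<in> core\<^sup>\<bottom>" for y z
        using contr[OF subspace_diff[OF subspace_orthogonal_comp that]]
        by (simp add: dist_norm linear_diff[OF linear_funpow[OF linear_T]])
    qed (use x in auto)
    then obtain z where "x + (T ^^ k) z = z" by blast
    then have "x = z - (T ^^ k) z" by (simp add: algebra_simps)
    also have "\<dots> = (\<Sum>j<k. A ((T ^^ j) z))"
      by (induction k) (simp_all add: A_def algebra_simps)
    also have "\<dots> = A (\<Sum>j<k. (T ^^ j) z)"
      by (simp add: linear_sum[OF linear_A])
    finally show "x \<in> perp_sum" using range_A_subset by blast
  qed
  then show False
    using assms perp_sum_subset by (auto simp: closed_perp_sum_iff)
qed

text \<open>Since \<open>norm ((T ^^ k) y)\<close> is nonincreasing in \<open>k\<close>, it is enough to keep it above a step function: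
  geometric levels, with the \<open>n\<close>-th level held up to a time \<open>N n\<close> after which the given sequence is below the
  next one.  The gliding hump for the operators \<open>T ^^ N n\<close> gives such a \<open>y\<close>.\<close>

lemma nonclosed_imp_arbitrarily_slow:
  assumes "\<not> closed perp_sum"
  shows "converges_arbitrarily_slowly T Q"
  unfolding converges_arbitrarily_slowly_def
proof (intro conjI allI impI T_iterates_converge)
  fix a :: "nat \<Rightarrow> real" assume a: "(\<forall>k. 0 < a k) \<and> a \<longlonglongrightarrow> 0"
  then have "Bseq a" using convergent_imp_Bseq convergentI by blast
  then obtain C where C: "C > 0" "\<And>k. norm (a k) \<le> C" by (auto elim: BseqE)
  have aC: "a k \<le> C" for k using C(2)[of k] by simp
  have "\<exists>N. \<forall>k\<ge>N. a k \<le> C * (1 / 3) ^ Suc n" for n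
  proof -
    have "\<forall>\<^sub>F k in sequentially. a k < C * (1 / 3) ^ Suc n"
      using a C(1) by (intro order_tendstoD(2)[of a 0]) auto
    then show ?thesis unfolding eventually_sequentially by (meson less_imp_le)
  qed
  then obtain N where N: "\<And>n k. k \<ge> N n \<Longrightarrow> a k \<le> C * (1 / 3) ^ Suc n" by metis
  have "\<exists>u. u \<in> core\<^sup>\<bottom> \<and> norm u \<le> 1 \<and> 3 / 4 \<le> norm ((T ^^ N n) u)" for n
    using nonclosed_imp_slow_vector[OF assms] by blast
  then obtain u where u: "\<And>n. u n \<in> core\<^sup>\<bottom>" "\<And>n. norm (u n) \<le> 1"
      "\<And>n. 3 / 4 \<le> norm ((T ^^ N n) (u n))" by metis
  obtain y where y: "y \<in> core\<^sup>\<bottom>" "\<And>n. (1 / 3) ^ n / 4 \<le> norm ((T ^^ N n) y)"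
    using gliding_hump[of "core\<^sup>\<bottom>" "\<lambda>n. T ^^ N n" u, OF subspace_orthogonal_comp
        closed_orthogonal_comp linear_funpow[OF linear_T] norm_funpow_le[of T, OF norm_T_le] u]
    by blast
  have "a k \<le> norm ((T ^^ k) ((4 * C) *\<^sub>R y) - Q ((4 * C) *\<^sub>R y))" for k
  proof -
    have level: "C * (1 / 3) ^ n \<le> 4 * C * norm ((T ^^ k) y)" if "k \<le> N n" for n
      using y(2)[of n] norm_T_pow_antimono[OF that, of y] C(1) by simp
    have tail: "(\<lambda>n. C * (1 / 3) ^ n) \<longlonglongrightarrow> C * 0"
      by (intro tendsto_intros LIMSEQ_power_zero) auto
    have "\<exists>n. k \<le> N n"
    proof (rule ccontr)
      assume "\<nexists>n. k \<le> N n"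
      then have "a k \<le> C * (1 / 3) ^ Suc n" for n
        using N[of n k] by (meson nat_le_linear)
      then have "a k \<le> C * 0"
        by (intro LIMSEQ_le_const[OF LIMSEQ_Suc[OF tail]]) blast
      moreover have "a k > 0" using a by blast
      ultimately show False by simp
    qed
    (* The least stage n with k <= N n: for n > 0 minimality gives N (n - 1) < k, so a k is below
       level n; for n = 0 this is the choice of C. *)
    define n where "n = (LEAST n. k \<le> N n)"
    have kn: "k \<le> N n" unfolding n_def using \<open>\<exists>n. k \<le> N n\<close> by (rule LeastI_ex)
    have "a k \<le> C * (1 / 3) ^ n"
    proof (cases n)
      case 0
      then show ?thesis using aC by simp
    next
      case (Suc m)
      then have "\<not> k \<le> N m" unfolding n_def by (intro not_less_Least) (simp add: n_def)
      then show ?thesis using N[of m k] Suc by simp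
    qed
    also have "\<dots> \<le> 4 * C * norm ((T ^^ k) y)" by (rule level[OF kn])
    also have "\<dots> = norm ((T ^^ k) ((4 * C) *\<^sub>R y) - Q ((4 * C) *\<^sub>R y))"
      using C(1) Q_perp[OF subspace_scale[OF subspace_orthogonal_comp y(1)]]
      by (simp add: linear_scale[OF linear_funpow[OF linear_T]])
    finally show ?thesis .
  qed
  then show "\<exists>x. \<forall>k. a k \<le> norm ((T ^^ k) x - Q x)" by blast
qed

section \<open>Super-polynomially fast convergence on a dense subspace\<close>

lemma T_pow_A_pow_decay: "real (Suc k) ^ n * (norm ((T ^^ (k * n)) ((A ^^ n) x)))\<^sup>2 \<le> (norm x)\<^sup>2"
proof (induction n)
  case (Suc n)
  let ?w = "(T ^^ (k * n)) ((A ^^ n) x)"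
  have "(T ^^ (k * Suc n)) ((A ^^ Suc n) x) = (T ^^ k) (A ?w)"
    by (simp add: funpow_add A_T_pow_commute)
  then have "real (Suc k) ^ Suc n * (norm ((T ^^ (k * Suc n)) ((A ^^ Suc n) x)))\<^sup>2
      = real (Suc k) ^ n * (real (Suc k) * (norm ((T ^^ k) (A ?w)))\<^sup>2)"
    by (simp only: power_Suc mult_ac)
  also have "\<dots> \<le> real (Suc k) ^ n * (norm ?w)\<^sup>2"
    by (intro mult_left_mono T_pow_A_decay) simp
  also have "\<dots> \<le> (norm x)\<^sup>2" by (rule Suc.IH)
  finally show ?case .
qed simp

text \<open>Each of the \<open>2 * m\<close> factors of \<open>A\<close> uses up about \<open>k / (2 * m)\<close> of the \<open>k\<close> iterations and gains a factor of
  order \<open>1 / sqrt k\<close>.\<close>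

lemma T_pow_decay_range:
  assumes "y \<in> range (A ^^ (2 * m))"
  obtains B where "\<And>k. real k ^ m * norm ((T ^^ k) y) \<le> B"
proof -
  obtain x where y: "y = (A ^^ (2 * m)) x" using assms by blast
  have "real k ^ m * norm ((T ^^ k) y) \<le> real (2 * m) ^ m * norm x" if "m > 0" for k
  proof -
    define l where "l = k div (2 * m)"
    have "k \<le> 2 * m * Suc l"
      using dividend_less_div_times[of "2 * m" k] \<open>m > 0\<close> by (simp add: l_def algebra_simps)
    then have k: "real k \<le> real (2 * m) * real (Suc l)"
      by (metis of_nat_le_iff of_nat_mult)
    have "l * (2 * m) \<le> k" by (simp add: l_def)
    have "(real (Suc l) ^ m * norm ((T ^^ (l * (2 * m))) y))\<^sup>2 \<le> (norm x)\<^sup>2"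
      using T_pow_A_pow_decay[of l "2 * m" x]
      by (simp only: y power_mult_distrib power_mult[symmetric] mult.commute)
    then have *: "real (Suc l) ^ m * norm ((T ^^ (l * (2 * m))) y) \<le> norm x"
      by (rule power2_le_imp_le) simp
    have "real k ^ m * norm ((T ^^ k) y)
        \<le> (real (2 * m) * real (Suc l)) ^ m * norm ((T ^^ (l * (2 * m))) y)"
      using k norm_T_pow_antimono[OF \<open>l * (2 * m) \<le> k\<close>] by (intro mult_mono power_mono) auto
    also have "\<dots> \<le> real (2 * m) ^ m * norm x"
      unfolding power_mult_distrib mult.assoc using * by (intro mult_left_mono) auto
    finally show ?thesis .
  qed
  moreover have "norm ((T ^^ k) y) \<le> norm y" for k
    by (rule norm_funpow_le[of T, OF norm_T_le])
  ultimately show ?thesis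
    using that by (cases "m = 0") auto
qed

text \<open>The vectors whose component orthogonal to the intersection can be divided by \<open>I - T\<close> arbitrarily
  often.\<close>

definition smooth_space :: "'a set" where
  "smooth_space = {x. x - Q x \<in> (\<Inter>n. range (A ^^ n))}"

lemma subspace_smooth_space: "subspace smooth_space"
proof -
  have "linear (\<lambda>x. x - Q x)"
    by (rule linear_compose_sub[OF linear_ident linear_Q])
  moreover have "subspace (\<Inter>n. range (A ^^ n))"
    by (intro subspace_Inter)
      (auto intro: linear_subspace_image[OF linear_funpow[OF linear_A] subspace_UNIV])
  ultimately have "subspace ((\<lambda>x. x - Q x) -` (\<Inter>n. range (A ^^ n)))"
    by (rule linear_subspace_vimage)
  then show ?thesis by (simp add: smooth_space_def vimage_def)
qed

lemma closure_smooth_space: "closure smooth_space = UNIV"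
proof -
  have "\<exists>z\<in>smooth_space. dist z x < e" if "e > 0" for x e
  proof -
    have "x - Q x \<in> closure (\<Inter>n. range (A ^^ n))"
      using dense_common_range[OF linear_A norm_A_le perp_subset_closure_A_perp] Q_residual by blast
    then obtain y where y: "y \<in> (\<Inter>n. range (A ^^ n))" "dist y (x - Q x) < e"
      using \<open>e > 0\<close> unfolding closure_approachable by blast
    have "y \<in> range (A ^^ Suc 0)" using y(1) by blast
    then have "y \<in> core\<^sup>\<bottom>" using A_in_perp by auto
    then have "Q (Q x + y) = Q x"
      using core Q_in by (intro metric_proj_eqI) simp_all
    then have "Q x + y \<in> smooth_space"
      using y(1) by (simp add: smooth_space_def)
    moreover have "dist (Q x + y) x < e"
      using y(2) by (simp add: dist_norm algebra_simps)
    ultimately show ?thesis by blast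
  qed
  then show ?thesis by (auto simp: closure_approachable)
qed

text \<open>Divisibility by the power \<open>2 * m\<close> of \<open>I - T\<close> gives decay of order \<open>m\<close>, and any \<open>m > \<alpha>\<close> will do.\<close>

lemma superpolynomial_on_smooth_space: "converges_super_polynomially_on T Q smooth_space"
  unfolding converges_super_polynomially_on_def
proof (intro conjI allI impI ballI T_iterates_converge)
  show "smooth_space \<noteq> {}" using subspace_0[OF subspace_smooth_space] by blast
  fix \<alpha> :: real and x assume "\<alpha> > 0" "x \<in> smooth_space"
  define y where "y = x - Q x"
  define m where "m = nat \<lceil>\<alpha>\<rceil> + 1"
  have m: "\<alpha> < real m" unfolding m_def by linarith
  have "y \<in> range (A ^^ (2 * m))"
    using \<open>x \<in> smooth_space\<close> unfolding smooth_space_def y_def by blast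
  then obtain B where B: "\<And>k. real k ^ m * norm ((T ^^ k) y) \<le> B"
    using T_pow_decay_range by blast
  show "(\<lambda>k. norm ((T ^^ k) x - Q x) / real k powr - \<alpha>) \<longlonglongrightarrow> 0"
  proof (rule tendsto_sandwich[of "\<lambda>_. 0" _ _ "\<lambda>k. B * real k powr (\<alpha> - real m)"])
    have "(\<lambda>k. real k powr (\<alpha> - real m)) \<longlonglongrightarrow> 0"
      using m by (intro tendsto_neg_powr filterlim_real_sequentially) simp
    from tendsto_mult_left[OF this, of B]
    show "(\<lambda>k. B * real k powr (\<alpha> - real m)) \<longlonglongrightarrow> 0" by simp
    show "\<forall>\<^sub>F k in sequentially. norm ((T ^^ k) x - Q x) / real k powr - \<alpha>
        \<le> B * real k powr (\<alpha> - real m)"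
      using eventually_gt_at_top[of 0]
    proof eventually_elim
      case (elim k)
      have "norm ((T ^^ k) x - Q x) / real k powr - \<alpha>
          = real k powr (\<alpha> - real m) * (real k ^ m * norm ((T ^^ k) y))"
        using elim by (simp add: T_pow_diff y_def powr_minus powr_diff powr_realpow divide_simps)
      also have "\<dots> \<le> real k powr (\<alpha> - real m) * B"
        using B by (intro mult_left_mono) auto
      finally show ?case by (simp add: mult.commute)
    qed
  qed auto
qed

end

theorem theorem14:
  fixes r :: nat
    and M :: "nat \<Rightarrow> 'a::{real_inner, complete_space} set"
    and T PM :: "'a \<Rightarrow> 'a"
    and q :: real
  assumes "r \<ge> 2"
    and "\<And>i. i \<in> {1..r} \<Longrightarrow> subspace (M i)"
    and "\<And>i. i \<in> {1..r} \<Longrightarrow> closed (M i)"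
  defines "T \<equiv> average_proj r M"
    and "PM \<equiv> metric_proj (\<Inter>i\<in>{1..r}. M i)"
    and "q \<equiv> (real r - 1) / real r * friedrichs_number r M + 1 / real r"
  shows "(closed (\<Sum>i=1..r. (M i)\<^sup>\<bottom>) \<and>
            converges_linearly T PM \<and>
            ((\<exists>i\<in>{1..r}. \<exists>j\<in>{1..r}. M i \<noteq> M j) \<longrightarrow>
               q \<in> linear_rates T PM \<and> (\<forall>q'\<in>linear_rates T PM. q \<le> q')))
         \<noteq>
         (\<not> closed (\<Sum>i=1..r. (M i)\<^sup>\<bottom>) \<and>
            converges_arbitrarily_slowly T PM \<and>
            (\<exists>X. subspace X \<and> closure X = UNIV \<and> converges_super_polynomially_on T PM X))"
proof -
  interpret subspace_family r M
    using assms(1-3) by unfold_locales auto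
  show ?thesis
  proof (cases "closed (\<Sum>i=1..r. (M i)\<^sup>\<bottom>)")
    case True
    then show ?thesis
      using closed_imp_converges_linearly friedrichs_rate_optimal[OF \<open>r \<ge> 2\<close> True]
      unfolding T_def PM_def q_def by blast
  next
    case False
    then show ?thesis
      using nonclosed_imp_arbitrarily_slow subspace_smooth_space closure_smooth_space
        superpolynomial_on_smooth_space
      unfolding T_def PM_def by blast
  qed
qed

end
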